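(* Let $q\geq 6$ be an even integer. There exist infinitely many bombs for which a particle starting from the left-hand wall of the unit square (at a point $(0,y)$ with $0<y<1$) with slope $\pm 3$ tunnels with period $q$.
   Context: Dynamics. The plane is covered by the unit square grid. The walls are the unit-length edges joining adjacent points of $\mathbb{Z}^2$ (each horizontal or vertical); the corners are the points of $\mathbb{Z}^2$. Initially every wall is solid. A bomb is a finite pattern of walls containing one marked horizontal wall (the one the particle will hit, from below) together with finitely many (possibly zero) other walls. A particle starts at a given point; "slope $s$" means its initial direction is $(1,s)/\sqrt{1+s^2}$ (so a start on the left-hand wall moves into the unit square; the starting wall itself is solid and being on it at time $0$ is not a collision). The particle moves in a straight line until it collides with a solid wall; it then reflects off, preserving the angle of incidence, and permanently erases all the walls obtained by moving the bomb by a rotation (and translation) so that the marked wall overlays the wall just hit and the particle is hitting the marked wall from below relative to the bomb. It passes freely through erased walls. If it reaches a corner it stops. Tunnels. A band is the set of points of the plane within a given finite distance of some ray $\ell$. A particle tunnels if it runs infinitely (without hitting a corner) and, for some $r$, every wall it collides with outside a disc of radius $r$ is contained in a finite union of bands. The tunnel is periodic if, for sufficiently large $r$, there is a positive integer $k$ such that (for collisions outside the disc) the wall hit in collision $n+k$ is always of the same type (horizontal/vertical) as the wall hit in collision $n$, and the displacement from the wall hit in collision $n$ to that hit in collision $n+k$ depends only on which band contains the wall hit in collision $n$; the least such $k$ is the period, and "tunnels with period $q$" means that it digs a periodic tunnel whose period is $q$. *)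

theory Defs
  imports "HOL-Analysis.Analysis"
begin

(* The plane is the type complex, so that the rotations of the grid are the
   multiplications by the powers of \<i>. A wall is its set of points. *)

definition corners :: "complex set" where
  "corners = {z. Re z \<in> \<int> \<and> Im z \<in> \<int>}"

definition horizontal :: "complex set \<Rightarrow> bool" where
  "horizontal w \<longleftrightarrow> (\<exists>z\<in>corners. w = closed_segment z (z + 1))"

definition vertical :: "complex set \<Rightarrow> bool" where
  "vertical w \<longleftrightarrow> (\<exists>z\<in>corners. w = closed_segment z (z + \<i>))"

definition walls :: "complex set set" where
  "walls = {w. horizontal w \<or> vertical w}"

(* Bombs matter only up to translation. Each one is represented by its unique
   translate whose marked wall is the segment from 0 to 1, so that translates
   of one pattern are not counted as different bombs. *)

definition marked_wall :: "complex set" where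
  "marked_wall = closed_segment 0 1"

definition bomb :: "complex set set \<Rightarrow> bool" where
  "bomb B \<longleftrightarrow> finite B \<and> B \<subseteq> walls \<and> marked_wall \<in> B"

(* The walls erased when a particle with velocity v hits the wall w. The motion
   z \<mapsto> a + u * z puts the marked wall on w; in the coordinates of the bomb the
   particle has velocity v / u, and it arrives from below iff the imaginary part
   of v / u is positive. This determines a and u. Reflections of the bomb are not
   allowed. As the marked wall belongs to the bomb, w itself is erased. *)

definition blast :: "complex set set \<Rightarrow> complex set \<Rightarrow> complex \<Rightarrow> complex set set" where
  "blast B w v = {(\<lambda>z. a + u * z) ` b | a u b.
     u \<in> {1, \<i>, -1, -\<i>} \<and> (\<lambda>z. a + u * z) ` marked_wall = w \<and> Im (v / u) > 0 \<and> b \<in> B}"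

record config =
  position :: complex
  velocity :: complex
  solid :: "complex set set"

definition start :: "real \<Rightarrow> real \<Rightarrow> config" where
  "start y s = \<lparr>position = Complex 0 y, velocity = Complex 1 s /\<^sub>R sqrt (1 + s\<^sup>2), solid = walls\<rparr>"

(* The particle reaches the solid wall w after time t, having met no solid wall
   and no corner in between, and it does not hit w at a corner. A corner stops the
   particle even if all walls around it are erased. Time 0 is exempt, so a
   start on a wall is not a collision. *)

definition hits :: "config \<Rightarrow> real \<Rightarrow> complex set \<Rightarrow> bool" where
  "hits \<sigma> t w \<longleftrightarrow> 0 < t \<and> w \<in> solid \<sigma> \<and>
     position \<sigma> + t *\<^sub>R velocity \<sigma> \<in> w - corners \<and>
     (\<forall>t'. 0 < t' \<and> t' < t \<longrightarrow> position \<sigma> + t' *\<^sub>R velocity \<sigma> \<notin> corners \<union> \<Union>(solid \<sigma>))"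

definition reflect :: "complex set \<Rightarrow> complex \<Rightarrow> complex" where
  "reflect w v = (if horizontal w then cnj v else - cnj v)"

definition collide :: "complex set set \<Rightarrow> config \<Rightarrow> real \<Rightarrow> complex set \<Rightarrow> config" where
  "collide B \<sigma> t w =
     \<lparr>position = position \<sigma> + t *\<^sub>R velocity \<sigma>,
      velocity = reflect w (velocity \<sigma>),
      solid = solid \<sigma> - blast B w (velocity \<sigma>)\<rparr>"

(* A run without end: for every n there is a collision number n (counting from 0),
   with the wall W n at the point X n. Since the unerased grid is regained
   outside a bounded set after finitely many collisions, a particle that is never
   stopped collides infinitely often; conversely infinitely many collisions take
   infinite time, as the distances between grid lines bound their frequency. *)

definition runs :: "complex set set \<Rightarrow> config \<Rightarrow> (nat \<Rightarrow> complex set) \<Rightarrow> (nat \<Rightarrow> complex) \<Rightarrow> bool" where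
  "runs B \<sigma>\<^sub>0 W X \<longleftrightarrow> (\<exists>\<sigma>. \<sigma> 0 = \<sigma>\<^sub>0 \<and>
     (\<forall>n. \<exists>t. hits (\<sigma> n) t (W n) \<and> \<sigma> (Suc n) = collide B (\<sigma> n) t (W n) \<and>
        X n = position (\<sigma> (Suc n))))"

definition ray :: "complex \<Rightarrow> complex \<Rightarrow> complex set" where
  "ray a u = {a + t *\<^sub>R u | t. 0 \<le> t}"

definition band :: "complex set \<Rightarrow> bool" where
  "band \<beta> \<longleftrightarrow> (\<exists>a u d. u \<noteq> 0 \<and> 0 \<le> d \<and> \<beta> = {z. infdist z (ray a u) \<le> d})"

definition tunnel :: "(nat \<Rightarrow> complex set) \<Rightarrow> (nat \<Rightarrow> complex) \<Rightarrow> bool" where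
  "tunnel W X \<longleftrightarrow> (\<exists>c r \<B>. finite \<B> \<and> (\<forall>\<beta>\<in>\<B>. band \<beta>) \<and>
     (\<forall>n. X n \<notin> cball c r \<longrightarrow> W n \<subseteq> \<Union>\<B>))"

(* That the displacement depends only on the band is expressed by the function \<delta>.
   A wall contained in several bands has to satisfy the condition for each. *)

definition repeats_outside ::
    "(nat \<Rightarrow> complex set) \<Rightarrow> (nat \<Rightarrow> complex) \<Rightarrow> complex set \<Rightarrow> nat \<Rightarrow> bool" where
  "repeats_outside W X D k \<longleftrightarrow> (\<exists>\<B> \<delta>. finite \<B> \<and> (\<forall>\<beta>\<in>\<B>. band \<beta>) \<and>
     (\<forall>n. X n \<notin> D \<longrightarrow>
        (horizontal (W (n + k)) \<longleftrightarrow> horizontal (W n)) \<and>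
        (\<exists>\<beta>\<in>\<B>. W n \<subseteq> \<beta>) \<and>
        (\<forall>\<beta>\<in>\<B>. W n \<subseteq> \<beta> \<longrightarrow> W (n + k) = (\<lambda>z. \<delta> \<beta> + z) ` W n)))"

(* The condition on r gets weaker as r grows, so the order of the quantifiers over
   r and k does not matter. *)

definition repeats :: "(nat \<Rightarrow> complex set) \<Rightarrow> (nat \<Rightarrow> complex) \<Rightarrow> nat \<Rightarrow> bool" where
  "repeats W X k \<longleftrightarrow> 0 < k \<and> (\<exists>c. \<forall>\<^sub>F r in at_top. repeats_outside W X (cball c r) k)"

definition tunnels_with_period :: "complex set set \<Rightarrow> config \<Rightarrow> nat \<Rightarrow> bool" where
  "tunnels_with_period B \<sigma>\<^sub>0 q \<longleftrightarrow> (\<exists>W X. runs B \<sigma>\<^sub>0 W X \<and> tunnel W X \<and>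
     (\<exists>k. repeats W X k) \<and> q = (LEAST k. repeats W X k))"

end

theory Submission
  imports Defs
begin

text \<open>
  A path of slope \<open>\<plusminus> 3\<close>, unfolded, crosses grid lines in the cyclic order horizontal, horizontal,
  horizontal, vertical, whatever the starting height, so the motion is a discrete process on cells.
  For \<open>q = 2 m + 2\<close> use a bomb with four essential walls: the marked wall from \<open>(0,0)\<close> to \<open>(1,0)\<close>, the
  vertical walls above \<open>(0,-2)\<close> and \<open>(1,0)\<close>, and a trigger, the horizontal wall to the right of
  \<open>(1-m,-m)\<close>. Unless disturbed, the particle climbs a diagonal staircase, hitting the top and the
  bottom of each cell; the vertical wall in front of it is erased by the hit from above. Each hit from
  above also erases the top wall of the cell \<open>m - 1\<close> steps ahead on the staircase. The particle finds
  it missing and flies on until it has hit two vertical walls, with one other hit between them; this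
  brings it onto a parallel staircase, displaced by \<open>(m, m-2)\<close> from the last one, beside the line of
  the remaining triggers. So the hits repeat with period \<open>2 m + 2\<close>, and this is the least period
  because the two vertical hits of a period are at distance \<open>2\<close> in a cycle of length at least \<open>6\<close>.
  A further wall far away from the tunnel in every orientation of the bomb gives infinitely many
  bombs.
\<close>

section \<open>Walls and bombs in integer coordinates\<close>

datatype edge = Hor int int | Ver int int

fun pts :: "edge \<Rightarrow> complex set" where
  "pts (Hor x y) = closed_segment (Complex x y) (Complex (x + 1) y)"
| "pts (Ver x y) = closed_segment (Complex x y) (Complex x (y + 1))"

lemma mem_pts_Hor: "z \<in> pts (Hor x y) \<longleftrightarrow> Im z = y \<and> x \<le> Re z \<and> Re z \<le> x + 1"
  by (auto simp: closed_segment_same_Im closed_segment_eq_real_ivl)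

lemma mem_pts_Ver: "z \<in> pts (Ver x y) \<longleftrightarrow> Re z = x \<and> y \<le> Im z \<and> Im z \<le> y + 1"
  by (auto simp: closed_segment_same_Re closed_segment_eq_real_ivl)

lemmas mem_pts = mem_pts_Hor mem_pts_Ver

lemma Complex_of_int_corner [simp]: "Complex (of_int x) (of_int y) \<in> corners"
  by (simp add: corners_def)

lemma corner_cases:
  assumes "z \<in> corners"
  obtains x y where "z = Complex (of_int x) (of_int y)"
  using assms by (auto simp: corners_def complex_eq_iff elim!: Ints_cases)

lemma horizontal_iff: "horizontal w \<longleftrightarrow> (\<exists>x y. w = pts (Hor x y))"
proof -
  have "Complex x y + 1 = Complex (x + 1) y" for x y by (simp add: complex_eq_iff)
  thus ?thesis unfolding horizontal_def
    by (auto elim!: corner_cases) (metis Complex_of_int_corner)+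
qed

lemma vertical_iff: "vertical w \<longleftrightarrow> (\<exists>x y. w = pts (Ver x y))"
proof -
  have "Complex x y + \<i> = Complex x (y + 1)" for x y by (simp add: complex_eq_iff)
  thus ?thesis unfolding vertical_def
    by (auto elim!: corner_cases) (metis Complex_of_int_corner)+
qed

lemma walls_eq: "walls = range pts"
  unfolding walls_def horizontal_iff vertical_iff
  by (auto simp del: pts.simps) (metis edge.exhaust)

text \<open>A non-corner point of a wall has exactly one non-integer coordinate, whose floor fixes
  the edge. Hence the wall met at a collision point is unambiguous.\<close>

lemma pts_unique:
  assumes "z \<in> pts e" "z \<in> pts e'" "z \<notin> corners"
  shows "e = e'"
proof -
  have *: "x = x'" if "of_int x \<le> r" "r \<le> of_int x + 1" "of_int x' \<le> r" "r \<le> of_int x' + 1" "r \<notin> \<int>"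
    for x x' :: int and r :: real
  proof -
    have "r \<noteq> of_int x + 1" "r \<noteq> of_int x' + 1"
      using that(5) by (metis Ints_1 Ints_add Ints_of_int)+
    hence "\<lfloor>r\<rfloor> = x" "\<lfloor>r\<rfloor> = x'" using that by (auto intro!: floor_unique)
    thus ?thesis by simp
  qed
  show ?thesis
    using assms by (cases e; cases e') (auto simp: mem_pts corners_def simp del: pts.simps intro!: *)
qed

lemma pts_midpoint:
  obtains z where "z \<in> pts e" "z \<notin> corners"
proof (cases e)
  case (Hor x y)
  have "of_int x + 1 / 2 \<notin> (\<int> :: real set)"
    by (metis Ints_of_int Ints_diff add_diff_cancel_left' fraction_not_in_Ints one_neq_zero Ints_1
        of_int_1 of_int_numeral even_numeral odd_one zero_neq_numeral)
  thus ?thesis using Hor by (intro that[of "Complex (x + 1/2) y"]) (auto simp: mem_pts corners_def simp del: pts.simps)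
next
  case (Ver x y)
  have "of_int y + 1 / 2 \<notin> (\<int> :: real set)"
    by (metis Ints_of_int Ints_diff add_diff_cancel_left' fraction_not_in_Ints one_neq_zero Ints_1
        of_int_1 of_int_numeral even_numeral odd_one zero_neq_numeral)
  thus ?thesis using Ver by (intro that[of "Complex x (y + 1/2)"]) (auto simp: mem_pts corners_def simp del: pts.simps)
qed

lemma inj_pts: "inj pts"
proof
  fix e e' assume "pts e = pts e'"
  thus "e = e'" using pts_midpoint[of e] pts_unique[of _ e e'] by metis
qed

lemma horizontal_pts: "horizontal (pts e) \<longleftrightarrow> (\<exists>x y. e = Hor x y)"
  unfolding horizontal_iff using inj_pts by (metis injD)

section \<open>Orientations of the bomb\<close>

datatype dir = Up | Down | Rgt | Lft

fun edge_at :: "dir \<Rightarrow> int \<Rightarrow> int \<Rightarrow> edge" where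
  "edge_at Up x y = Hor x y"
| "edge_at Down x y = Hor x y"
| "edge_at Rgt x y = Ver x y"
| "edge_at Lft x y = Ver x y"

text \<open>Rotation of the bomb with \<open>Up\<close> as reference. The offsets of one arise
  because a rotation may exchange the endpoints of an edge, which is always named by its left or
  lower one.\<close>

fun place :: "dir \<Rightarrow> int \<Rightarrow> int \<Rightarrow> edge \<Rightarrow> edge" where
  "place Up x y (Hor p q) = Hor (x + p) (y + q)"
| "place Up x y (Ver p q) = Ver (x + p) (y + q)"
| "place Down x y (Hor p q) = Hor (x - p) (y - q)"
| "place Down x y (Ver p q) = Ver (x + 1 - p) (y - 1 - q)"
| "place Rgt x y (Hor p q) = Ver (x + q) (y - p)"
| "place Rgt x y (Ver p q) = Hor (x + q) (y + 1 - p)"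
| "place Lft x y (Hor p q) = Ver (x - q) (y + p)"
| "place Lft x y (Ver p q) = Hor (x - 1 - q) (y + p)"

fun turn :: "dir \<Rightarrow> complex" where
  "turn Up = 1" | "turn Down = -1" | "turn Rgt = -\<i>" | "turn Lft = \<i>"

fun shift :: "dir \<Rightarrow> int \<Rightarrow> int \<Rightarrow> complex" where
  "shift Up x y = Complex x y"
| "shift Down x y = Complex (x + 1) y"
| "shift Rgt x y = Complex x (y + 1)"
| "shift Lft x y = Complex x y"

fun heading :: "dir \<Rightarrow> complex \<Rightarrow> bool" where
  "heading Up v \<longleftrightarrow> Im v > 0"
| "heading Down v \<longleftrightarrow> Im v < 0"
| "heading Rgt v \<longleftrightarrow> Re v > 0"
| "heading Lft v \<longleftrightarrow> Re v < 0"

lemma affine_closed_segment: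
  fixes a u :: complex
  shows "(\<lambda>z. a + u * z) ` closed_segment p q = closed_segment (a + u * p) (a + u * q)"
  using closed_segment_translation[of a "u * p" "u * q"] closed_segment_linear_image[of "(*) u" p q]
  by (simp add: image_image bounded_linear.linear bounded_linear_mult_right)

lemma place_image: "(\<lambda>z. shift d x y + turn d * z) ` pts e = pts (place d x y e)"
proof -
  have *: "closed_segment a b = closed_segment c d" if "a = c \<and> b = d \<or> a = d \<and> b = c" for a b c d :: complex
    using that closed_segment_commute by metis
  show ?thesis
    by (cases d; cases e; simp only: pts.simps place.simps turn.simps shift.simps affine_closed_segment; rule *)
       (simp_all add: complex_eq_iff)
qed

lemma marked_wall_eq: "marked_wall = pts (Hor 0 0)"
  by (simp add: marked_wall_def Complex_eq)

text \<open>Only two opposite rotations can lay the marked wall along a given edge, and the side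
  from which the particle comes selects one of them.\<close>

lemma turn_unique:
  assumes "u \<in> {1, \<i>, -1, -\<i>}" "(\<lambda>z. a + u * z) ` marked_wall = pts (edge_at d x y)"
    "Im (v / u) > 0" "heading d v"
  shows "u = turn d \<and> a = shift d x y"
proof -
  have eq: "closed_segment a (a + u) = pts (edge_at d x y)"
    using assms(2) by (simp add: marked_wall_def affine_closed_segment)
  have 1: "a \<in> pts (edge_at d x y)" "a + u \<in> pts (edge_at d x y)"
    using eq by auto
  have i: "v / \<i> = - \<i> * v" "v / (-\<i>) = \<i> * v" by (simp_all add: field_simps)
  have *: ?thesis if "Im (v / u) > 0" "u = 1 \<or> u = \<i> \<or> u = -1 \<or> u = -\<i>"
    using that(2) that(1) assms(4) 1
    by (cases d; elim disjE; hypsubst)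
       (auto simp: mem_pts i complex_eq_iff simp del: pts.simps)
  thus ?thesis using assms(1,3) by blast
qed

lemma blast_eq:
  assumes "heading d v"
  shows "blast (pts ` B) (pts (edge_at d x y)) v = pts ` place d x y ` B"
proof -
  have turn: "Im (v / turn d) > 0"
    using assms by (cases d) simp_all
  have shape: "turn d \<in> {1, \<i>, -1, -\<i>}"
    by (cases d) simp_all
  have placed: "(\<lambda>z. shift d x y + turn d * z) ` marked_wall = pts (edge_at d x y)"
    unfolding marked_wall_eq place_image by (cases d) simp_all
  show ?thesis
  proof (intro subset_antisym subsetI)
    fix w assume "w \<in> blast (pts ` B) (pts (edge_at d x y)) v"
    then obtain a u e where *: "w = (\<lambda>z. a + u * z) ` pts e" "u \<in> {1, \<i>, -1, -\<i>}"
      "(\<lambda>z. a + u * z) ` marked_wall = pts (edge_at d x y)" "Im (v / u) > 0" "e \<in> B"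
      unfolding blast_def by blast
    have "w = pts (place d x y e)"
      using turn_unique[OF *(2-4) assms] *(1) place_image[of d x y e] by simp
    thus "w \<in> pts ` place d x y ` B"
      using *(5) by simp
  next
    fix w assume "w \<in> pts ` place d x y ` B"
    then obtain e where "e \<in> B" "w = (\<lambda>z. shift d x y + turn d * z) ` pts e"
      unfolding place_image by blast
    thus "w \<in> blast (pts ` B) (pts (edge_at d x y)) v"
      unfolding blast_def mem_Collect_eq using shape turn placed
      by (intro exI[of _ "shift d x y"] exI[of _ "turn d"] exI[of _ "pts e"]) simp
  qed
qed

section \<open>Straight flight through the cells\<close>

text \<open>The phase counts crossings modulo 4 in the unfolded path: in phases 0, 1 and 2 the next grid
  line is horizontal, in phase 3 it is vertical. The directions are those after the last crossing.\<close>

datatype cell_state = St (col: int) (row: int) (rightward: bool) (upward: bool) (phase: nat)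

fun next_dir :: "cell_state \<Rightarrow> dir" where
  "next_dir (St x y r u n) = (if n < 3 then if u then Up else Down else if r then Rgt else Lft)"

fun next_x :: "cell_state \<Rightarrow> int" where
  "next_x (St x y r u n) = (if n \<ge> 3 \<and> r then x + 1 else x)"

fun next_y :: "cell_state \<Rightarrow> int" where
  "next_y (St x y r u n) = (if n < 3 \<and> u then y + 1 else y)"

definition next_edge :: "cell_state \<Rightarrow> edge" where
  "next_edge s = edge_at (next_dir s) (next_x s) (next_y s)"

fun pass :: "cell_state \<Rightarrow> cell_state" where
  "pass (St x y r u n) =
    (if n < 3 then St x (if u then y + 1 else y - 1) r u (n + 1)
     else St (if r then x + 1 else x - 1) y r u 0)"

text \<open>A reflection is an ordinary crossing of the unfolded path, which is why the phase
  advances exactly as in \<open>pass\<close>.\<close>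

fun bounce :: "cell_state \<Rightarrow> cell_state" where
  "bounce (St x y r u n) = (if n < 3 then St x y r (\<not> u) (n + 1) else St x y (\<not> r) u 0)"

definition glides :: "edge set \<Rightarrow> cell_state \<Rightarrow> cell_state \<Rightarrow> bool" where
  "glides E s s' \<longleftrightarrow> (\<exists>k. s' = (pass ^^ k) s \<and> (\<forall>i<k. next_edge ((pass ^^ i) s) \<in> E))"

lemma glides_refl: "s = s' \<Longrightarrow> glides E s s'"
  unfolding glides_def by (rule exI[of _ 0]) simp

lemma glides_step:
  assumes "next_edge s \<in> E" "glides E (pass s) s'"
  shows "glides E s s'"
proof -
  obtain k where k: "s' = (pass ^^ k) (pass s)" "\<And>i. i < k \<Longrightarrow> next_edge ((pass ^^ i) (pass s)) \<in> E"
    using assms(2) by (auto simp: glides_def)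
  have "next_edge ((pass ^^ i) s) \<in> E" if "i < Suc k" for i
    using assms(1) k(2) that by (cases i) (simp_all del: funpow.simps add: funpow_Suc_right)
  thus ?thesis unfolding glides_def using k(1)
    by (intro exI[of _ "Suc k"]) (simp del: funpow.simps add: funpow_Suc_right)
qed

definition erased_by :: "edge set \<Rightarrow> cell_state \<Rightarrow> edge set" where
  "erased_by B s = place (next_dir s) (next_x s) (next_y s) ` B"

text \<open>In direction of motion, the fraction of the cell already traversed when a phase begins. The
  parameter \<open>\<eta>\<close> is the vertical fraction just after a vertical grid line: the starting height \<open>y\<close>
  for slope 3, and \<open>1 - y\<close> for slope -3.\<close>

definition x_frac :: "real \<Rightarrow> nat \<Rightarrow> real" where
  "x_frac \<eta> n = (if n = 0 then 0 else (n - \<eta>) / 3)"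

definition y_frac :: "real \<Rightarrow> nat \<Rightarrow> real" where
  "y_frac \<eta> n = (if n = 0 then \<eta> else 0)"

fun pos :: "real \<Rightarrow> cell_state \<Rightarrow> complex" where
  "pos \<eta> (St x y r u n) =
     Complex (if r then x + x_frac \<eta> n else x + 1 - x_frac \<eta> n)
             (if u then y + y_frac \<eta> n else y + 1 - y_frac \<eta> n)"

fun vel :: "cell_state \<Rightarrow> complex" where
  "vel (St x y r u n) = Complex (if r then 1 else -1) (if u then 3 else -3) /\<^sub>R sqrt 10"

definition config_of :: "real \<Rightarrow> cell_state \<Rightarrow> edge set \<Rightarrow> config" where
  "config_of \<eta> s E = \<lparr>position = pos \<eta> s, velocity = vel s, solid = pts ` (- E)\<rparr>"

text \<open>The factor \<open>sqrt 10\<close> turns horizontal distance into time, the horizontal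
  speed being its reciprocal.\<close>

definition duration :: "real \<Rightarrow> nat \<Rightarrow> real" where
  "duration \<eta> n = sqrt 10 * (if n = 0 then (1 - \<eta>) / 3 else if n = 3 then \<eta> / 3 else 1 / 3)"

lemma less_4_cases: "n \<le> 3 \<Longrightarrow> n = 0 \<or> n = 1 \<or> n = 2 \<or> n = (3::nat)"
  by arith

lemma vel_pass: "vel (pass s) = vel s"
  by (cases s) simp

lemma phase_pass: "phase s \<le> 3 \<Longrightarrow> phase (pass s) \<le> 3"
  by (cases s) simp

lemma phase_bounce: "phase s \<le> 3 \<Longrightarrow> phase (bounce s) \<le> 3"
  by (cases s) simp

lemma reflect_next_edge:
  assumes "phase s \<le> 3"
  shows "reflect (pts (next_edge s)) (vel s) = vel (bounce s)"
  using assms by (cases s) (auto simp: reflect_def horizontal_pts next_edge_def complex_eq_iff simp del: pts.simps)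

lemma heading_next_dir:
  assumes "phase s \<le> 3"
  shows "heading (next_dir s) (vel s)"
  using assms by (cases s) auto

context
  fixes \<eta> :: real
  assumes \<eta>: "0 < \<eta>" "\<eta> < 1"
begin

lemma duration_pos: "0 < duration \<eta> n"
  using \<eta> by (auto simp: duration_def)

lemma pos_after_duration:
  assumes "phase s \<le> 3"
  shows "pos \<eta> s + duration \<eta> (phase s) *\<^sub>R vel s = pos \<eta> (pass s)"
    and "pos \<eta> (bounce s) = pos \<eta> (pass s)"
  using assms
  by (cases s; auto simp: complex_eq_iff duration_def x_frac_def y_frac_def field_simps dest!: less_4_cases)+

lemma pos_pass_next_edge:
  assumes "phase s \<le> 3"
  shows "pos \<eta> (pass s) \<in> pts (next_edge s)" "pos \<eta> (pass s) \<notin> corners"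
proof -
  show "pos \<eta> (pass s) \<in> pts (next_edge s)"
    using assms \<eta>
    by (cases s; auto simp: next_edge_def mem_pts x_frac_def y_frac_def simp del: pts.simps dest!: less_4_cases)
  have frac: "of_int k + f \<notin> \<int>" "of_int k + 1 - f \<notin> \<int>"
     if "0 < f" "f < 1" for k :: int and f :: real
  proof -
    have f: "f \<notin> \<int>" using that by (auto elim!: Ints_cases)
    show "of_int k + f \<notin> \<int>" using f by (metis Ints_diff Ints_of_int add_diff_cancel_left')
    have "f = of_int (k + 1) - (of_int k + 1 - f)" by simp
    thus "of_int k + 1 - f \<notin> \<int>" using f by (metis Ints_diff Ints_of_int)
  qed
  show "pos \<eta> (pass s) \<notin> corners"
  proof (cases s)
    case (St x y r u n)
    show ?thesis
    proof (cases "n < 3")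
      case True
      have "0 < (real n + 1 - \<eta>) / 3" "(real n + 1 - \<eta>) / 3 < 1"
        using True \<eta> by auto
      from frac[OF this, of x] show ?thesis
        using True St by (auto simp: corners_def x_frac_def add.commute)
    next
      case False
      with frac[OF \<eta>, of y] St show ?thesis by (auto simp: corners_def y_frac_def)
    qed
  qed
qed

text \<open>Strictly within a phase both coordinates lie strictly between consecutive integers,
  while every point of a wall has an integer coordinate.\<close>

lemma in_flight:
  assumes "phase s \<le> 3" "0 < t" "t < duration \<eta> (phase s)"
  shows "pos \<eta> s + t *\<^sub>R vel s \<notin> corners \<union> \<Union>(range pts)"
proof -
  obtain x y r u n where s: "s = St x y r u n" by (cases s)
  define \<theta> where "\<theta> = t / sqrt 10"
  have \<theta>: "0 < \<theta>" using assms by (simp add: \<theta>_def)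
  have b: "\<theta> < duration \<eta> n / sqrt 10"
    using assms s by (simp add: \<theta>_def divide_strict_right_mono)
  hence f: "0 < x_frac \<eta> n + \<theta>" "x_frac \<eta> n + \<theta> < 1" "0 < y_frac \<eta> n + 3 * \<theta>" "y_frac \<eta> n + 3 * \<theta> < 1"
    using \<theta> \<eta> assms(1) s
    by (auto simp: duration_def x_frac_def y_frac_def field_simps dest!: less_4_cases)
  have R: "Re (pos \<eta> s + t *\<^sub>R vel s) = (if r then x + (x_frac \<eta> n + \<theta>) else x + 1 - (x_frac \<eta> n + \<theta>))"
    and I: "Im (pos \<eta> s + t *\<^sub>R vel s) = (if u then y + (y_frac \<eta> n + 3 * \<theta>) else y + 1 - (y_frac \<eta> n + 3 * \<theta>))"
    by (simp_all add: s \<theta>_def divide_inverse)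
  define z where "z = pos \<eta> s + t *\<^sub>R vel s"
  have z: "x < Re z" "Re z < real_of_int x + 1" "y < Im z" "Im z < real_of_int y + 1"
    using f unfolding z_def R I by auto
  have no: "r \<noteq> of_int j" if "of_int i < r" "r < of_int i + 1" for i j :: int and r :: real
  proof
    assume "r = of_int j"
    hence "i < j" "j < i + 1" using that by linarith+
    thus False by simp
  qed
  have "z \<notin> pts e" for e
    using no[OF z(1,2)] no[OF z(3,4)] by (cases e) (auto simp: mem_pts simp del: pts.simps)
  moreover have "z \<notin> corners"
    using no[OF z(1,2)] by (auto simp: corners_def elim!: Ints_cases)
  ultimately show ?thesis unfolding z_def by auto
qed

text \<open>Induction on the number of crossings: inside a phase no wall is met, and at a crossing
  the only wall through the point is the erased \<open>next_edge\<close>.\<close>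

lemma flight:
  assumes "phase s \<le> 3" "\<And>i. i < k \<Longrightarrow> next_edge ((pass ^^ i) s) \<in> E"
  shows "\<exists>t\<ge>0. pos \<eta> ((pass ^^ k) s) = pos \<eta> s + t *\<^sub>R vel s \<and>
    (\<forall>t'. 0 < t' \<and> t' \<le> t \<longrightarrow> pos \<eta> s + t' *\<^sub>R vel s \<notin> corners \<union> \<Union>(pts ` (- E)))"
  using assms(2)
proof (induction k)
  case 0
  show ?case by (rule exI[of _ 0]) auto
next
  case (Suc k)
  obtain t where t: "t \<ge> 0" "pos \<eta> ((pass ^^ k) s) = pos \<eta> s + t *\<^sub>R vel s"
    "\<And>t'. 0 < t' \<Longrightarrow> t' \<le> t \<Longrightarrow> pos \<eta> s + t' *\<^sub>R vel s \<notin> corners \<union> \<Union>(pts ` (- E))"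
    using Suc.IH Suc.prems by (metis less_SucI)
  define p where "p = (pass ^^ k) s"
  have ph: "phase p \<le> 3"
    unfolding p_def using assms(1) by (induction k) (simp_all add: phase_pass)
  have v: "vel p = vel s"
    unfolding p_def by (induction k) (simp_all add: vel_pass)
  define d where "d = duration \<eta> (phase p)"
  have d: "d > 0" unfolding d_def by (rule duration_pos)
  have split: "pos \<eta> s + t' *\<^sub>R vel s = pos \<eta> p + (t' - t) *\<^sub>R vel p" for t'
    unfolding p_def t(2) v[unfolded p_def] by (simp add: algebra_simps)
  have "pos \<eta> s + t' *\<^sub>R vel s \<notin> corners \<union> \<Union>(pts ` (- E))" if t': "0 < t'" "t' \<le> t + d" for t'
  proof -
    consider "t' \<le> t" | "t < t'" "t' - t < d" | "t' - t = d" using t' by linarith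
    thus ?thesis
    proof cases
      case 1 thus ?thesis using t(3) t' by blast
    next
      case 2 thus ?thesis unfolding split using in_flight[OF ph, of "t' - t"] d_def by auto
    next
      case 3
      have "pos \<eta> p + (t' - t) *\<^sub>R vel p = pos \<eta> (pass p)"
        unfolding 3 d_def by (rule pos_after_duration(1)[OF ph])
      moreover have "e = next_edge p" if "pos \<eta> (pass p) \<in> pts e" for e
        using pts_unique that pos_pass_next_edge[OF ph] by metis
      moreover have "next_edge p \<in> E" using Suc.prems[of k] p_def by simp
      ultimately show ?thesis unfolding split using pos_pass_next_edge(2)[OF ph] by auto
    qed
  qed
  moreover have "pos \<eta> ((pass ^^ Suc k) s) = pos \<eta> s + (t + d) *\<^sub>R vel s"
    using split[of "t + d"] pos_after_duration(1)[OF ph] by (simp add: d_def p_def)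
  ultimately show ?case using t(1) d by (intro exI[of _ "t + d"]) auto
qed

lemma hit_after_passes:
  assumes "phase s \<le> 3" "\<And>i. i < k \<Longrightarrow> next_edge ((pass ^^ i) s) \<in> E"
    and s': "s' = (pass ^^ k) s" "next_edge s' \<notin> E"
  shows "\<exists>t. hits (config_of \<eta> s E) t (pts (next_edge s')) \<and>
    config_of \<eta> (bounce s') (E \<union> erased_by B s') = collide (pts ` B) (config_of \<eta> s E) t (pts (next_edge s'))"
proof -
  obtain t where t: "t \<ge> 0" "pos \<eta> s' = pos \<eta> s + t *\<^sub>R vel s"
    "\<And>t'. 0 < t' \<Longrightarrow> t' \<le> t \<Longrightarrow> pos \<eta> s + t' *\<^sub>R vel s \<notin> corners \<union> \<Union>(pts ` (- E))"
    using flight[OF assms(1,2), of k] s'(1) by blast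
  have ph: "phase s' \<le> 3"
    unfolding s'(1) using assms(1) by (induction k) (simp_all add: phase_pass)
  have v: "vel s' = vel s"
    unfolding s'(1) by (induction k) (simp_all add: vel_pass)
  define d where "d = duration \<eta> (phase s')"
  have d: "d > 0" unfolding d_def by (rule duration_pos)
  have split: "pos \<eta> s + t' *\<^sub>R vel s = pos \<eta> s' + (t' - t) *\<^sub>R vel s'" for t'
    unfolding t(2) v by (simp add: algebra_simps)
  have arrive: "pos \<eta> s + (t + d) *\<^sub>R vel s = pos \<eta> (pass s')"
    unfolding split using pos_after_duration(1)[OF ph] by (simp add: d_def)
  have "pos \<eta> s + t' *\<^sub>R vel s \<notin> corners \<union> \<Union>(pts ` (- E))" if t': "0 < t'" "t' < t + d" for t'
  proof (cases "t' \<le> t")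
    case True thus ?thesis using t(3) t' by blast
  next
    case False
    thus ?thesis unfolding split using in_flight[OF ph, of "t' - t"] t' d_def by auto
  qed
  hence "hits (config_of \<eta> s E) (t + d) (pts (next_edge s'))"
    using arrive pos_pass_next_edge[OF ph] s'(2) t(1) d
    by (simp add: hits_def config_of_def)
  moreover have "pts ` (- E) - blast (pts ` B) (pts (next_edge s')) (vel s) = pts ` (- (E \<union> erased_by B s'))"
    unfolding next_edge_def blast_eq[OF heading_next_dir[OF ph, unfolded v]]
    by (simp add: erased_by_def image_set_diff[OF inj_pts] Compl_Un flip: Diff_eq)
  ultimately show ?thesis
    using arrive pos_after_duration(2)[OF ph] reflect_next_edge[OF ph, unfolded v]
    by (intro exI[of _ "t + d"]) (simp add: collide_def config_of_def)
qed

end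

text \<open>Below, \<open>s n\<close> is the state from which collision \<open>n\<close> is the next crossing.\<close>

definition erased_before :: "edge set \<Rightarrow> (nat \<Rightarrow> cell_state) \<Rightarrow> nat \<Rightarrow> edge set" where
  "erased_before B s n = (\<Union>i<n. erased_by B (s i))"

text \<open>Existence of the run becomes a question about edges alone: which of them survive the
  earlier blasts and which are gone.\<close>

lemma runsI:
  assumes \<eta>: "0 < \<eta>" "\<eta> < 1"
    and ph: "\<And>n. phase (s n) \<le> 3"
    and solid: "\<And>n. next_edge (s n) \<notin> erased_before B s n"
    and glides: "\<And>n. glides (erased_before B s (Suc n)) (bounce (s n)) (s (Suc n))"
  shows "runs (pts ` B) (config_of \<eta> (s 0) {}) (\<lambda>n. pts (next_edge (s n))) (\<lambda>n. pos \<eta> (pass (s n)))"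
proof -
  \<comment> \<open>Before a collision n > 0 the particle sits where it last bounced;
    \<open>s n\<close> is reached only by the glide. Before the first collision there is no
    glide.\<close>
  define \<sigma> where "\<sigma> n = config_of \<eta> (case n of 0 \<Rightarrow> s 0 | Suc k \<Rightarrow> bounce (s k)) (erased_before B s n)" for n
  have *: "erased_before B s (Suc n) = erased_before B s n \<union> erased_by B (s n)" for n
    by (auto simp: erased_before_def less_Suc_eq)
  have "\<exists>t. hits (\<sigma> n) t (pts (next_edge (s n))) \<and> \<sigma> (Suc n) = collide (pts ` B) (\<sigma> n) t (pts (next_edge (s n)))" for n
  proof (cases n)
    case 0
    show ?thesis
      using hit_after_passes[OF \<eta> ph[of 0], of 0 "{}" "s 0" B]
      by (simp add: 0 \<sigma>_def erased_before_def lessThan_Suc)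
  next
    case (Suc k)
    obtain j where "s n = (pass ^^ j) (bounce (s k))"
      "\<And>i. i < j \<Longrightarrow> next_edge ((pass ^^ i) (bounce (s k))) \<in> erased_before B s n"
      using glides[of k] Suc by (auto simp: glides_def)
    from hit_after_passes[OF \<eta> phase_bounce[OF ph] this(2,1) solid[of n]]
    show ?thesis by (simp add: \<sigma>_def Suc *)
  qed
  thus ?thesis
    unfolding runs_def
    by (intro exI[of _ \<sigma>]) (auto simp: \<sigma>_def erased_before_def config_of_def pos_after_duration[OF \<eta> ph])
qed

lemma start_eq:
  "start y 3 = config_of y (St 0 0 True True 0) {}"
  "start y (-3) = config_of (1 - y) (St 0 0 True False 0) {}"
  by (simp_all add: start_def config_of_def walls_eq x_frac_def y_frac_def)

section \<open>The bombs and the hit sequence\<close>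

text \<open>\<open>Hor (1 - m) (- m)\<close> is the trigger; \<open>Hor (-k) k\<close> is the inert wall that distinguishes the bombs.\<close>

definition digger :: "nat \<Rightarrow> int \<Rightarrow> edge set" where
  "digger m k = {Hor 0 0, Ver 0 (-2), Ver 1 0, Hor (1 - int m) (- int m), Hor (-k) k}"

text \<open>The state before hit \<open>j < 2 m + 2\<close> of a period whose staircase starts in the cell \<open>(a, b)\<close>: first
  the staircase, alternately bottom and top walls, then top, right, bottom, left, top.\<close>

definition period_state :: "nat \<Rightarrow> int \<Rightarrow> int \<Rightarrow> nat \<Rightarrow> cell_state" where
  "period_state m a b j =
    (if j + 3 < 2 * m then
       (if even j then St (a + int (j div 2)) (b + int (j div 2)) True False 1
        else St (a + int (Suc j div 2)) (b + int (Suc j div 2)) True True 0)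
     else if j + 3 = 2 * m then St (a + m - 1) (b + m) True True 1
     else if j + 2 = 2 * m then St (a + m - 1) (b + m - 1) True False 3
     else if j + 1 = 2 * m then St (a + m - 1) (b + m - 1) False False 0
     else if j = 2 * m then St (a + m - 1) (b + m + 1) False True 3
     else St (a + m - 1) (b + m + 1) True True 0)"

lemma period_index_cases:
  fixes m j :: nat
  assumes "2 \<le> m" "j < 2 * m + 2"
  obtains i where "i + 2 \<le> m" "j = 2 * i" | i where "1 \<le> i" "i + 2 \<le> m" "j = 2 * i - 1"
    | "j = 2 * m - 3" | "j = 2 * m - 2" | "j = 2 * m - 1" | "j = 2 * m" | "j = 2 * m + 1"
proof (cases "j + 3 < 2 * m")
  case True
  thus thesis using that(1)[of "j div 2"] that(2)[of "Suc j div 2"] by (cases "even j") (auto elim!: evenE oddE)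
next
  case False
  thus thesis using assms that(3-7) by linarith
qed

text \<open>\<open>D\<close> and \<open>U\<close> are the bottom and top hits of the staircase, the
  other cases form the change of staircase. Indices are given by linear integer equations, without
  parity or division.\<close>

lemma period_state_cases [consumes 2, case_names D U Us R Ds L Ul]:
  assumes "2 \<le> m" "j < 2 * m + 2"
  obtains i :: int where "0 \<le> i" "i + 2 \<le> int m" "int j = 2 * i" "period_state m a b j = St (a + i) (b + i) True False 1"
  | i :: int where "1 \<le> i" "i + 2 \<le> int m" "int j + 1 = 2 * i" "period_state m a b j = St (a + i) (b + i) True True 0"
  | "int j + 3 = 2 * int m" "period_state m a b j = St (a + m - 1) (b + m) True True 1"
  | "int j + 2 = 2 * int m" "period_state m a b j = St (a + m - 1) (b + m - 1) True False 3"
  | "int j + 1 = 2 * int m" "period_state m a b j = St (a + m - 1) (b + m - 1) False False 0"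
  | "int j = 2 * int m" "period_state m a b j = St (a + m - 1) (b + m + 1) False True 3"
  | "int j = 2 * int m + 1" "period_state m a b j = St (a + m - 1) (b + m + 1) True True 0"
  using assms
proof (cases rule: period_index_cases)
  case (1 i)
  thus thesis using that(1)[of "int i"] by (simp add: period_state_def)
next
  case (2 i)
  hence "odd j" "Suc j div 2 = i" "j + 3 < 2 * m" by presburger+
  thus thesis using that(2)[of "int i"] 2 by (simp add: period_state_def)
qed (use assms that(3-7) in \<open>simp_all add: period_state_def\<close>)

text \<open>The primed period is \<open>c\<close> periods later, so \<open>A\<close> stands for the nonlinear term \<open>c m\<close>; with it as an
  unknown all comparisons of coordinates are linear.\<close>

lemma period_state_hit_solid:
  fixes A c :: int
  assumes m: "2 \<le> m" and k: "int m + 6 \<le> k" and j: "j < 2 * m + 2" "j' < 2 * m + 2"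
    and c: "c = 0 \<and> A = 0 \<and> j < j' \<or> c = 1 \<and> A = m \<or> 2 \<le> c \<and> 2 * int m \<le> A \<and> 2 * c \<le> A"
  shows "next_edge (period_state m (a + A) (b + A - 2 * c) j') \<notin> erased_by (digger m k) (period_state m a b j)"
  using m j(1)
\<comment> \<open>For each pair of hit types, equality of the edges contradicts the linear bounds.
  The inert wall erased by \<open>R\<close> lies \<open>k\<close> steps ahead on the diagonal, from
  which later periods drift off by \<open>2 * c\<close>; for all other hits it lies too far left or
  too far below for any later hit.\<close>
proof (cases rule: period_state_cases[where a = a and b = b])
  case (D i)
  show ?thesis using m j(2)
    by (cases rule: period_state_cases[where a = "a + A" and b = "b + A - 2 * c"];
        use c k m D in \<open>auto simp: erased_by_def next_edge_def digger_def; linarith\<close>)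
next
  case (U i)
  show ?thesis using m j(2)
    by (cases rule: period_state_cases[where a = "a + A" and b = "b + A - 2 * c"]; use c k m U in \<open>auto simp: erased_by_def next_edge_def digger_def; linarith\<close>)
next
  case Us
  show ?thesis using m j(2)
    by (cases rule: period_state_cases[where a = "a + A" and b = "b + A - 2 * c"]; use c k m Us in \<open>auto simp: erased_by_def next_edge_def digger_def; linarith\<close>)
next
  case R
  show ?thesis using m j(2)
    by (cases rule: period_state_cases[where a = "a + A" and b = "b + A - 2 * c"]; use c k m R in \<open>auto simp: erased_by_def next_edge_def digger_def; linarith\<close>)
next
  case Ds
  show ?thesis using m j(2)
    by (cases rule: period_state_cases[where a = "a + A" and b = "b + A - 2 * c"]; use c k m Ds in \<open>auto simp: erased_by_def next_edge_def digger_def; linarith\<close>)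
next
  case L
  show ?thesis using m j(2)
    by (cases rule: period_state_cases[where a = "a + A" and b = "b + A - 2 * c"]; use c k m L in \<open>auto simp: erased_by_def next_edge_def digger_def; linarith\<close>)
next
  case Ul
  show ?thesis using m j(2)
    by (cases rule: period_state_cases[where a = "a + A" and b = "b + A - 2 * c"]; use c k m Ul in \<open>auto simp: erased_by_def next_edge_def digger_def; linarith\<close>)
qed

lemma period_state_simps:
  "i + 2 \<le> m \<Longrightarrow> period_state m a b (2 * i) = St (a + int i) (b + int i) True False 1"
  "1 \<le> i \<Longrightarrow> i + 2 \<le> m \<Longrightarrow> period_state m a b (2 * i - 1) = St (a + int i) (b + int i) True True 0"
  "2 \<le> m \<Longrightarrow> period_state m a b (2 * m - 3) = St (a + m - 1) (b + m) True True 1"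
  "2 \<le> m \<Longrightarrow> period_state m a b (2 * m - 2) = St (a + m - 1) (b + m - 1) True False 3"
  "2 \<le> m \<Longrightarrow> period_state m a b (2 * m - 1) = St (a + m - 1) (b + m - 1) False False 0"
  "period_state m a b (2 * m) = St (a + m - 1) (b + m + 1) False True 3"
  "period_state m a b (2 * m + 1) = St (a + m - 1) (b + m + 1) True True 0"
proof -
  show "period_state m a b (2 * i - 1) = St (a + int i) (b + int i) True True 0" if i: "1 \<le> i" "i + 2 \<le> m"
  proof -
    obtain l where "i = Suc l" using i by (cases i) auto
    thus ?thesis using i by (simp add: period_state_def)
  qed
qed (auto simp: period_state_def)

text \<open>\<open>lo\<close> is the first hit of this period in the actual run: after a start with slope -3 the run joins
  its first period at hit \<open>2 m - 3\<close>.\<close>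

lemma period_glides:
  assumes m: "2 \<le> m" and j: "j < 2 * m + 2" "lo \<le> j" and lo: "lo = 0 \<or> lo + 3 = 2 * m"
    and own: "\<And>i. lo \<le> i \<Longrightarrow> i \<le> j \<Longrightarrow> erased_by (digger m k) (period_state m a b i) \<subseteq> E"
    and trigger: "Hor (a + m - 1) (b + m) \<in> E"
    and first: "lo = 0 \<Longrightarrow> Hor a (b + 1) \<in> E"
  shows "glides E (bounce (period_state m a b j))
    (if j = 2 * m + 1 then period_state m (a + m) (b + m - 2) 0 else period_state m a b (Suc j))"
proof -
  \<comment> \<open>The wall hit above the trigger is crossed twice later in the period.\<close>
  have Us: "Hor (a + m - 1) (b + m + 1) \<in> E" if "2 * m - 3 \<le> j"
  proof -
    have "Hor (a + m - 1) (b + m + 1) \<in> erased_by (digger m k) (period_state m a b (2 * m - 3))"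
      unfolding period_state_simps(3)[OF m] by (simp add: erased_by_def digger_def)
    moreover have "lo \<le> 2 * m - 3" using lo by linarith
    ultimately show ?thesis using own[of "2 * m - 3"] that by blast
  qed
  \<comment> \<open>Turned by hit \<open>R\<close>, the bomb wall \<open>Ver 1 0\<close> becomes the
    top wall of the first cell of the next staircase.\<close>
  have R: "Ver (a + m) (b + m - 1) \<in> E" "Hor (a + m) (b + m - 1) \<in> E" if "2 * m - 2 \<le> j"
  proof -
    have "{Ver (a + m) (b + m - 1), Hor (a + m) (b + m - 1)} \<subseteq> erased_by (digger m k) (period_state m a b (2 * m - 2))"
      unfolding period_state_simps(4)[OF m] by (simp add: erased_by_def digger_def)
    moreover have "lo \<le> 2 * m - 2" using lo by linarith
    ultimately show "Ver (a + m) (b + m - 1) \<in> E" "Hor (a + m) (b + m - 1) \<in> E"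
      using own[of "2 * m - 2"] that by blast+
  qed
  consider i where "i + 2 \<le> m" "j = 2 * i" | i where "1 \<le> i" "i + 2 \<le> m" "j = 2 * i - 1"
    | "j = 2 * m - 3" | "j = 2 * m - 2" | "j = 2 * m - 1" | "j = 2 * m" | "j = 2 * m + 1"
    using m j(1) by (rule period_index_cases)
  thus ?thesis
  proof cases
    case (1 i)
    have lo0: "lo = 0" using lo j(2) 1 by linarith
    note s = period_state_simps(1)[OF 1(1), of a b, folded 1(2)]
    \<comment> \<open>The top wall of the current cell fell to the preceding top hit or, in the
      first cell, before the staircase began.\<close>
    have "Hor (a + i) (b + i + 1) \<in> E"
    proof (cases "i = 0")
      case True thus ?thesis using first lo0 by simp
    next
      case False
      hence "Hor (a + i) (b + i + 1) \<in> erased_by (digger m k) (period_state m a b (2 * i - 1))"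
        using 1 period_state_simps(2)[of i m a b] by (simp add: erased_by_def digger_def del: One_nat_def)
      thus ?thesis using own[of "2 * i - 1"] 1 lo0 by auto
    qed
    \<comment> \<open>Turned upside down, \<open>Ver 0 (-2)\<close> is the vertical wall that the
      particle meets after rising one cell.\<close>
    moreover have "Ver (a + i + 1) (b + i + 1) \<in> erased_by (digger m k) (period_state m a b j)"
      unfolding s by (simp add: erased_by_def digger_def)
    hence "Ver (a + i + 1) (b + i + 1) \<in> E"
      using own[of j] j(2) by auto
    ultimately have g: "glides E (bounce (period_state m a b j)) s'"
      if "glides E (St (a + i + 1) (b + i + 1) True True 0) s'" for s'
      unfolding s using that by (simp add: next_edge_def glides_step)
    \<comment> \<open>If the next cell is the last of the staircase, its top wall is the erased
      trigger and the particle flies one cell higher.\<close>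
    show ?thesis
    proof (cases "i + 2 = m")
      case True
      hence "Suc j = 2 * m - 3" "j \<noteq> 2 * m + 1" "int m = i + 2" using 1 by linarith+
      moreover have "glides E (St (a + i + 1) (b + i + 1) True True 0) (period_state m a b (2 * m - 3))"
        unfolding period_state_simps(3)[OF m] using \<open>int m = i + 2\<close> trigger
        by (intro glides_step[OF _ glides_refl]) (simp_all add: next_edge_def algebra_simps)
      ultimately show ?thesis using g by simp
    next
      case False
      hence "Suc j = 2 * Suc i - 1" "j \<noteq> 2 * m + 1" using 1 by presburger+
      moreover have "glides E (St (a + i + 1) (b + i + 1) True True 0) (period_state m a b (2 * Suc i - 1))"
        using False 1(1) period_state_simps(2)[of "Suc i" m a b]
        by (intro glides_refl) (simp add: add_ac)
      ultimately show ?thesis using g by simp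
    qed
  next
    case (2 i)
    hence *: "Suc j = 2 * i" "j \<noteq> 2 * m + 1" by linarith+
    show ?thesis unfolding if_not_P[OF *(2)] *(1)
      unfolding 2(3) period_state_simps(1)[OF 2(2)] period_state_simps(2)[OF 2(1,2)]
      by (simp add: glides_refl)
  next
    case 3
    hence *: "Suc j = 2 * m - 2" "j \<noteq> 2 * m + 1" using m by linarith+
    show ?thesis unfolding if_not_P[OF *(2)] *(1)
      unfolding 3 period_state_simps(3,4)[OF m]
      using trigger by (intro glides_step[OF _ glides_refl]) (simp_all add: next_edge_def)
  next
    case 4
    hence *: "Suc j = 2 * m - 1" "j \<noteq> 2 * m + 1" using m by linarith+
    show ?thesis unfolding if_not_P[OF *(2)] *(1)
      unfolding 4 period_state_simps(4,5)[OF m] by (simp add: glides_refl)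
  next
    case 5
    hence *: "Suc j = 2 * m" "j \<noteq> 2 * m + 1" using m by linarith+
    have "2 * m - 3 \<le> j" using 5 by simp
    thus ?thesis unfolding if_not_P[OF *(2)] *(1)
      unfolding 5 period_state_simps(5)[OF m] period_state_simps(6)
      using trigger Us
      by (intro glides_step[OF _ glides_step[OF _ glides_refl]]) (simp_all add: next_edge_def 5)
  next
    case 6
    hence *: "Suc j = 2 * m + 1" "j \<noteq> 2 * m + 1" by simp_all
    show ?thesis unfolding if_not_P[OF *(2)] *(1)
      unfolding 6 period_state_simps(6,7) by (simp add: glides_refl)
  next
    case 7
    have s0: "period_state m (a + m) (b + m - 2) 0 = St (a + m) (b + m - 2) True False 1"
      using period_state_simps(1)[of 0 m] m by simp
    \<comment> \<open>Four crossings follow: down through the wall of \<open>Us\<close> and the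
      trigger, right through the wall of \<open>R\<close>, and down into the next staircase.\<close>
    have "2 * m - 3 \<le> j" "2 * m - 2 \<le> j" using 7 by simp_all
    thus ?thesis unfolding if_P[OF 7] s0
      unfolding 7 period_state_simps(7)
      using trigger Us R
      by (intro glides_step[OF _ glides_step[OF _ glides_step[OF _ glides_step[OF _ glides_refl]]]])
         (simp_all add: next_edge_def 7)
  qed
qed

section \<open>The whole sequence of shifted periods\<close>

definition path :: "nat \<Rightarrow> int \<Rightarrow> int \<Rightarrow> nat \<Rightarrow> cell_state" where
  "path m a b n = (let c = int (n div (2 * m + 2)) in
     period_state m (a + c * m) (b + c * m - 2 * c) (n mod (2 * m + 2)))"

lemma path_eq:
  "j < 2 * m + 2 \<Longrightarrow> path m a b (p * (2 * m + 2) + j) = period_state m (a + int p * m) (b + int p * m - 2 * int p) j"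
proof -
  assume j: "j < 2 * m + 2"
  have "(p * (2 * m + 2) + j) div (2 * m + 2) = p" "(p * (2 * m + 2) + j) mod (2 * m + 2) = j"
    using j div_mult_self3[of "2 * m + 2" p j] by (simp_all del: mult_Suc mult_Suc_right add_2_eq_Suc' div_mult_self3)
  thus ?thesis by (simp only: path_def Let_def)
qed

lemma path_cases:
  fixes n m :: nat
  obtains p j where "n = p * (2 * m + 2) + j" "j < 2 * m + 2"
  by (metis add.commute div_mult_mod_eq mod_less_divisor add_gr_0 zero_less_numeral)

lemma path_hit_solid:
  assumes m: "2 \<le> m" and k: "int m + 6 \<le> k" and less: "n < n'"
  shows "next_edge (path m a b n') \<notin> erased_by (digger m k) (path m a b n)"
proof -
  obtain p j where n: "n = p * (2 * m + 2) + j" "j < 2 * m + 2" by (rule path_cases)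
  obtain p' j' where n': "n' = p' * (2 * m + 2) + j'" "j' < 2 * m + 2" by (rule path_cases)
  define c where "c = int p' - int p"
  have "p \<le> p'"
  proof (rule ccontr)
    assume "\<not> p \<le> p'"
    hence "Suc p' * (2 * m + 2) \<le> p * (2 * m + 2)" by (intro mult_le_mono1) simp
    thus False using n n' less by simp
  qed
  hence "0 \<le> c" by (simp add: c_def)
  moreover have "j < j'" if "c = 0" using that n n' less by (simp add: c_def)
  \<comment> \<open>The product \<open>c * m\<close> now takes the place of the unknown
    \<open>A\<close>; these bounds are all that is kept of it.\<close>
  moreover have "2 * int m \<le> c * m" "2 * c \<le> c * m" if "2 \<le> c"
    using that m mult_right_mono[of 2 c "int m"] mult_left_mono[of 2 "int m" c] by (simp_all add: mult.commute)
  ultimately have "c = 0 \<and> c * m = 0 \<and> j < j' \<or> c = 1 \<and> c * m = m \<or> 2 \<le> c \<and> 2 * int m \<le> c * m \<and> 2 * c \<le> c * m"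
    by (cases "c = 0"; cases "c = 1") auto
  from period_state_hit_solid[OF m k n(2) n'(2) this, of "a + int p * m" "b + int p * m - 2 * int p"]
  show ?thesis unfolding n(1) n'(1) path_eq[OF n(2)] path_eq[OF n'(2)]
    by (simp add: c_def algebra_simps)
qed

section \<open>Tunnels and their period\<close>

lemma div_mod_mult_add:
  assumes "Q \<noteq> (0::nat)" "j < Q"
  shows "(p * Q + j) div Q = p" "(p * Q + j) mod Q = j"
  using assms by simp_all

lemma pts_translate:
  "(\<lambda>z. Complex (of_int x) (of_int y) + z) ` pts e = pts (place Up x y e)"
  using place_image[of Up x y e] by simp

lemma next_edge_period_shift:
  "next_edge (period_state m (a + x) (b + y) j) = place Up x y (next_edge (period_state m a b j))"
  by (auto simp: period_state_def next_edge_def)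

lemma horizontal_period:
  assumes "2 \<le> m" "j < 2 * m + 2"
  shows "horizontal (pts (next_edge (period_state m a b j))) \<longleftrightarrow> j \<noteq> 2 * m - 2 \<and> j \<noteq> 2 * m"
  using assms unfolding horizontal_pts by (auto simp: period_state_def next_edge_def)

lemma near_period:
  assumes "2 \<le> m" "j < 2 * m + 2" "z \<in> pts (next_edge (period_state m a b j))"
  shows "\<bar>Re z - a\<bar> \<le> m + 3 \<and> \<bar>Im z - b\<bar> \<le> m + 3"
  using assms(1,2)
  by (cases rule: period_state_cases[where a = a and b = b];
      use assms(1,3) in \<open>auto simp: next_edge_def mem_pts simp del: pts.simps\<close>)

text \<open>The first hit \<open>s0\<close> lies outside the periodic pattern, which the run joins at index \<open>j0\<close>.\<close>

locale digging =
  fixes m :: nat and k a b :: int and j0 :: nat and s0 :: cell_state and \<eta> :: real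
  assumes m: "2 \<le> m" and k: "int m + 6 \<le> k"
    and j0: "j0 = 0 \<or> j0 + 3 = 2 * m"
    and \<eta>: "0 < \<eta>" "\<eta> < 1"
    and phase_s0: "phase s0 \<le> 3"
    and bounce_s0: "bounce s0 = path m a b j0"
    and solid_s0: "\<And>n. j0 \<le> n \<Longrightarrow> next_edge (path m a b n) \<notin> erased_by (digger m k) s0"
    and first_s0: "j0 = 0 \<Longrightarrow> Hor a (b + 1) \<in> erased_by (digger m k) s0"
    and trigger_s0: "j0 \<noteq> 0 \<Longrightarrow> Hor (a + m - 1) (b + m) \<in> erased_by (digger m k) s0"
begin

abbreviation "Q \<equiv> 2 * m + 2"

definition states :: "nat \<Rightarrow> cell_state" where
  "states n = (case n of 0 \<Rightarrow> s0 | Suc l \<Rightarrow> path m a b (l + j0))"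

abbreviation "W \<equiv> \<lambda>n. pts (next_edge (states n))"
abbreviation "X \<equiv> \<lambda>n. pos \<eta> (pass (states n))"

lemma states_simps [simp]: "states 0 = s0" "states (Suc l) = path m a b (l + j0)"
  by (simp_all add: states_def)

lemma path_glides:
  assumes n: "j0 \<le> n" and E: "erased_by (digger m k) s0 \<subseteq> E"
    "\<And>i. j0 \<le> i \<Longrightarrow> i \<le> n \<Longrightarrow> erased_by (digger m k) (path m a b i) \<subseteq> E"
  shows "glides E (bounce (path m a b n)) (path m a b (Suc n))"
proof -
  obtain p j where pj: "n = p * Q + j" "j < Q" by (rule path_cases)
  define a' b' where "a' = a + int p * m" and "b' = b + int p * m - 2 * int p"
  have path': "path m a b (p * Q + i) = period_state m a' b' i" if "i < Q" for i
    using path_eq[OF that] by (simp add: a'_def b'_def)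
  \<comment> \<open>Only the initial period can be incomplete, since the run may join it at
    \<open>j0\<close>.\<close>
  define lo where "lo = (if p = 0 then j0 else 0)"
  have lo: "j0 \<le> p * Q + i" if "lo \<le> i" for i
  proof (cases "p = 0")
    case True thus ?thesis using that by (simp add: lo_def)
  next
    case False
    have "j0 \<le> 1 * Q" using j0 by auto
    also have "\<dots> \<le> p * Q" using False by (intro mult_le_mono1) simp
    finally show ?thesis by (rule trans_le_add1)
  qed
  \<comment> \<open>The trigger fell to the first staircase hit of this period or, if the run skips
    that hit, to \<open>s0\<close>.\<close>
  have "Hor (a' + m - 1) (b' + m) \<in> E"
  proof (cases "lo = 0")
    case True
    have "period_state m a' b' 0 = St a' b' True False 1"
      using m by (simp add: period_state_def)
    hence D: "path m a b (p * Q + 0) = St a' b' True False 1"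
      by (rule trans[OF path', rotated]) simp
    have "Hor (a' + m - 1) (b' + m) \<in> erased_by (digger m k) (path m a b (p * Q + 0))"
      unfolding D by (simp add: erased_by_def digger_def)
    moreover have "j0 \<le> p * Q + 0" "p * Q + 0 \<le> n"
      using lo[of 0] True pj(1) by simp_all
    ultimately show ?thesis using E(2) by blast
  next
    case False
    thus ?thesis using trigger_s0 E(1) by (auto simp: lo_def a'_def b'_def split: if_splits)
  qed
  \<comment> \<open>The top wall of the first cell fell to hit \<open>R\<close> of the previous
    period or, in the initial period, to \<open>s0\<close>.\<close>
  moreover have "Hor a' (b' + 1) \<in> E" if "lo = 0"
  proof (cases p)
    case 0
    thus ?thesis using that first_s0 E(1) by (auto simp: lo_def a'_def b'_def)
  next
    case (Suc p')
    have "path m a b (p' * Q + (2 * m - 2)) =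
        period_state m (a + int p' * m) (b + int p' * m - 2 * int p') (2 * m - 2)"
      by (rule path_eq) simp
    also have "\<dots> = St (a' - 1) (b' + 1) True False 3"
      unfolding period_state_simps(4)[OF m] by (simp add: a'_def b'_def Suc algebra_simps)
    finally have "Hor a' (b' + 1) \<in> erased_by (digger m k) (path m a b (p' * Q + (2 * m - 2)))"
      by (simp add: erased_by_def digger_def)
    moreover have "j0 \<le> p' * Q + (2 * m - 2)" using j0 by linarith
    moreover have "p' * Q + (2 * m - 2) \<le> n" unfolding pj(1) Suc by simp
    ultimately show ?thesis using E(2) by blast
  qed
  moreover have "erased_by (digger m k) (period_state m a' b' i) \<subseteq> E" if "lo \<le> i" "i \<le> j" for i
  proof -
    have "path m a b (p * Q + i) = period_state m a' b' i"
      by (rule path') (use that(2) pj(2) in linarith)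
    moreover have "p * Q + i \<le> n" unfolding pj(1) using that(2) by simp
    ultimately show ?thesis using E(2)[OF lo[OF that(1)]] by simp
  qed
  moreover have "lo \<le> j" "lo = 0 \<or> lo + 3 = 2 * m"
    using n pj j0 by (auto simp: lo_def)
  ultimately have g: "glides E (bounce (period_state m a' b' j))
      (if j = 2 * m + 1 then period_state m (a' + m) (b' + m - 2) 0 else period_state m a' b' (Suc j))"
    using period_glides[OF m pj(2), of lo k a' b' E] by blast
  have "path m a b (Suc n) = (if j = 2 * m + 1 then period_state m (a' + m) (b' + m - 2) 0 else period_state m a' b' (Suc j))"
  proof (cases "j = 2 * m + 1")
    case True
    have n: "Suc n = Suc p * Q + 0" using pj(1) True by simp
    have "path m a b (Suc p * Q + 0) =
        period_state m (a + int (Suc p) * m) (b + int (Suc p) * m - 2 * int (Suc p)) 0"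
      by (rule path_eq) simp
    also have "\<dots> = period_state m (a' + m) (b' + m - 2) 0"
      by (simp add: a'_def b'_def algebra_simps)
    finally show ?thesis unfolding n if_P[OF True] .
  next
    case False
    hence "Suc n = p * Q + Suc j" "Suc j < Q" using pj by simp_all
    thus ?thesis using path' False by metis
  qed
  thus ?thesis using g path'[OF pj(2)] pj(1) by simp
qed

lemma phase_states: "phase (states n) \<le> 3"
proof (cases n)
  case 0 thus ?thesis using phase_s0 by simp
next
  case (Suc l)
  obtain p j where "l + j0 = p * Q + j" "j < Q" by (rule path_cases)
  thus ?thesis using path_eq[of j m a b p] Suc by (simp add: period_state_def)
qed

lemma runs: "runs (pts ` digger m k) (config_of \<eta> s0 {}) W X"
proof -
  have "runs (pts ` digger m k) (config_of \<eta> (states 0) {}) W X"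
  proof (rule runsI[OF \<eta>])
    fix n
    show "phase (states n) \<le> 3" by (rule phase_states)
    show "next_edge (states n) \<notin> erased_before (digger m k) states n"
    proof (cases n)
      case 0 thus ?thesis by (simp add: erased_before_def)
    next
      case (Suc l)
      have "next_edge (path m a b (l + j0)) \<notin> erased_by (digger m k) (states i)" if "i < Suc l" for i
        using that solid_s0[of "l + j0"] path_hit_solid[OF m k, of "i - 1 + j0" "l + j0" a b] by (cases i) simp_all
      thus ?thesis using Suc by (auto simp: erased_before_def)
    qed
    show "glides (erased_before (digger m k) states (Suc n)) (bounce (states n)) (states (Suc n))"
    proof (cases n)
      case 0 thus ?thesis using bounce_s0 by (simp add: glides_refl)
    next
      case (Suc l)
      have "erased_by (digger m k) (states i) \<subseteq> erased_before (digger m k) states (Suc n)" if "i < Suc n" for i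
        using that by (auto simp: erased_before_def)
      from this[of 0] this[of "Suc (i - j0)" for i]
      have "erased_by (digger m k) s0 \<subseteq> erased_before (digger m k) states (Suc n)"
        "\<And>i. j0 \<le> i \<Longrightarrow> i \<le> l + j0 \<Longrightarrow>
           erased_by (digger m k) (path m a b i) \<subseteq> erased_before (digger m k) states (Suc n)"
        by (simp, metis Suc le_add_diff_inverse2 le_diff_conv less_Suc_eq_le Suc_less_eq states_simps(2))
      hence "glides (erased_before (digger m k) states (Suc n)) (bounce (path m a b (l + j0))) (path m a b (Suc (l + j0)))"
        by (intro path_glides) simp_all
      thus ?thesis by (simp add: Suc)
    qed
  qed
  thus ?thesis by simp
qed

lemma states_period:
  "0 < n \<Longrightarrow> W (n + Q) = (\<lambda>z. Complex m (real m - 2) + z) ` W n"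
proof -
  assume "0 < n"
  then obtain l where l: "n = Suc l" by (cases n) auto
  obtain p j where pj: "l + j0 = p * Q + j" "j < Q" by (rule path_cases)
  have "l + Q + j0 = Suc p * Q + j" using pj by simp
  moreover have "n + Q = Suc (l + Q)" by (simp add: l)
  ultimately have "next_edge (states (n + Q)) = next_edge (path m a b (Suc p * Q + j))"
    by (simp only: states_simps)
  also have "\<dots> = next_edge (period_state m ((a + int p * m) + int m) ((b + int p * m - 2 * int p) + (int m - 2)) j)"
    unfolding path_eq[OF pj(2)] by (simp add: algebra_simps)
  also have "\<dots> = place Up m (int m - 2) (next_edge (states n))"
    unfolding next_edge_period_shift by (simp only: l states_simps pj(1) path_eq[OF pj(2)])
  finally show ?thesis using pts_translate[of "int m" "int m - 2"] by simp
qed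

lemma states_near:
  assumes "0 < n"
  obtains p where "\<And>z. z \<in> W n \<Longrightarrow> \<bar>Re z - (a + real p * m)\<bar> \<le> m + 3"
    "\<And>z. z \<in> W n \<Longrightarrow> \<bar>Im z - (b + real p * (real m - 2))\<bar> \<le> m + 3"
proof -
  obtain l where l: "n = Suc l" using assms by (cases n) auto
  obtain p j where pj: "l + j0 = p * Q + j" "j < Q" by (rule path_cases)
  have e: "next_edge (states n) = next_edge (period_state m (a + int p * m) (b + int p * m - 2 * int p) j)"
    using path_eq[OF pj(2)] by (simp add: l pj)
  show thesis
    using near_period[OF m pj(2), of _ "a + int p * m" "b + int p * m - 2 * int p", folded e] pj l
    by (intro that[of p]) (auto simp: algebra_simps)
qed

lemma X_in_W: "X n \<in> W n"
  using pos_pass_next_edge(1)[OF \<eta> phase_states] .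

text \<open>The ray follows the displacement of one period. The width adds the bounds
  \<open>m + 3\<close> for both coordinates, which dominates the modulus.\<close>

definition tunnel_band :: "complex set" where
  "tunnel_band = {z. infdist z (ray (Complex a b) (Complex m (real m - 2))) \<le> 2 * m + 6}"

lemma band_tunnel_band: "band tunnel_band"
  unfolding band_def tunnel_band_def using m by (intro exI conjI) (auto simp: complex_eq_iff)

lemma W_subset_band:
  assumes "0 < n"
  shows "W n \<subseteq> tunnel_band"
proof
  fix z assume z: "z \<in> W n"
  obtain p where p: "\<bar>Re z - (a + real p * m)\<bar> \<le> m + 3" "\<bar>Im z - (b + real p * (real m - 2))\<bar> \<le> m + 3"
    using states_near[OF assms] z by metis
  define c where "c = Complex a b + real p *\<^sub>R Complex m (real m - 2)"
  have "c \<in> ray (Complex a b) (Complex m (real m - 2))"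
    unfolding ray_def c_def by auto
  moreover have "dist z c \<le> 2 * m + 6"
    using cmod_le[of "z - c"] p by (simp add: dist_norm c_def)
  ultimately show "z \<in> tunnel_band"
    unfolding tunnel_band_def using infdist_le order_trans by blast
qed

lemma W_horizontal:
  assumes "0 < n"
  shows "horizontal (W n) \<longleftrightarrow> (n - 1 + j0) mod Q \<noteq> 2 * m - 2 \<and> (n - 1 + j0) mod Q \<noteq> 2 * m"
proof -
  obtain l where l: "n = Suc l" using assms by (cases n) auto
  obtain p j where pj: "l + j0 = p * Q + j" "j < Q" by (rule path_cases)
  have "(l + j0) mod Q = j" unfolding pj(1) by (rule div_mod_mult_add) (use pj in simp_all)
  thus ?thesis using horizontal_period[OF m pj(2)] path_eq[OF pj(2)] by (simp add: l pj)
qed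

text \<open>The real part of the pattern grows by \<open>m\<close> per period, so every hit type
  recurs beyond any disc. This allows a candidate period to be tested at chosen hits.\<close>

lemma outside:
  assumes "j < Q"
  obtains n where "0 < n" "(n - 1 + j0) mod Q = j" "X n \<notin> cball c r"
proof -
  obtain p :: nat where p: "real p > \<bar>Re c\<bar> + r + \<bar>a\<bar> + m + 4" using reals_Archimedean2 by blast
  define p' where "p' = p + 1"
  define n where "n = Suc (p' * Q + j - j0)"
  have j0': "j0 \<le> p' * Q + j" using j0 by (auto simp: p'_def)
  have n: "n - 1 + j0 = p' * Q + j" using j0' by (simp add: n_def)
  have e: "next_edge (states n) = next_edge (period_state m (a + int p' * m) (b + int p' * m - 2 * int p') j)"
    using path_eq[OF assms, of a b p'] n by (simp add: n_def j0')
  have "\<bar>Re (X n) - (a + real p' * m)\<bar> \<le> m + 3"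
    using near_period[OF m assms X_in_W[of n, unfolded e]] by simp
  moreover have "real p' * m \<ge> real p'" "real p' = real p + 1"
    using m mult_left_mono[of 1 "real m" "real p'"] by (simp_all add: p'_def)
  ultimately have "Re (X n) - Re c > r" using p by linarith
  hence "X n \<notin> cball c r"
    using abs_Re_le_cmod[of "X n - c"] by (simp add: dist_norm norm_minus_commute)
  moreover have "(n - 1 + j0) mod Q = j" unfolding n by (rule div_mod_mult_add) (use assms in simp_all)
  ultimately show thesis using that[of n] by (simp add: n_def)
qed

lemma repeats_Q: "repeats W X Q"
proof -
  \<comment> \<open>The radius excludes \<open>X 0\<close>, the collision before the pattern; beyond
    it a single band with constant displacement serves.\<close>
  have "repeats_outside W X (cball 0 r) Q" if r: "norm (X 0) \<le> r" for r
  proof -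
    have pos: "0 < n" if "X n \<notin> cball 0 r" for n using that r by (cases n) auto
    have "horizontal (W (n + Q)) = horizontal (W n)" if "0 < n" for n
      using that W_horizontal[OF that] W_horizontal[of "n + Q"] mod_add_self2[of "n - 1 + j0" Q]
      by (simp add: algebra_simps)
    thus ?thesis
      unfolding repeats_outside_def using pos W_subset_band states_period band_tunnel_band
      by (intro exI[of _ "{tunnel_band}"] exI[of _ "\<lambda>_. Complex m (real m - 2)"]) auto
  qed
  hence "\<forall>\<^sub>F r in at_top. repeats_outside W X (cball 0 r) Q"
    unfolding eventually_at_top_linorder by blast
  thus ?thesis unfolding repeats_def by auto
qed

text \<open>The shift by \<open>l\<close> maps the vertical residues \<open>2 * m - 2\<close> and
  \<open>2 * m\<close> modulo \<open>Q\<close> into themselves. If 0 < \<open>l\<close> <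
  \<open>Q\<close> it exchanges them, so \<open>l\<close> is congruent to both 2 and -2 and
  \<open>Q\<close> divides 4, although \<open>Q\<close> is at least 6.\<close>

lemma repeats_ge:
  assumes "repeats W X l"
  shows "Q \<le> l"
proof (rule ccontr)
  assume "\<not> Q \<le> l"
  hence l: "0 < l" "l < Q" using assms by (auto simp: repeats_def)
  obtain c r where "repeats_outside W X (cball c r) l"
    using assms unfolding repeats_def eventually_at_top_linorder by blast
  hence same: "horizontal (W (n + l)) = horizontal (W n)" if "X n \<notin> cball c r" for n
    using that unfolding repeats_outside_def by blast
  have same': "(j + l) mod Q = 2 * m - 2 \<or> (j + l) mod Q = 2 * m" if j: "j = 2 * m - 2 \<or> j = 2 * m" for j
  proof -
    have "j < Q" using j by auto
    then obtain n where n: "0 < n" "(n - 1 + j0) mod Q = j" "X n \<notin> cball c r" by (rule outside)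
    have "(n + l - 1 + j0) mod Q = (j + l) mod Q"
      using n(1) mod_add_left_eq[of "n - 1 + j0" Q l] unfolding n(2) by (simp add: algebra_simps)
    thus ?thesis using same[OF n(3)] W_horizontal[OF n(1)] W_horizontal[of "n + l"] n j by auto
  qed
  have "(2 * m - 2 + l) mod Q = (if 2 * m - 2 + l < Q then 2 * m - 2 + l else 2 * m - 2 + l - Q)"
    "(2 * m + l) mod Q = (if 2 * m + l < Q then 2 * m + l else 2 * m + l - Q)"
    using l by (auto simp: mod_if)
  thus False using same'[of "2 * m - 2"] same'[of "2 * m"] l m by (auto split: if_splits)
qed

lemma tunnels: "tunnels_with_period (pts ` digger m k) (config_of \<eta> s0 {}) Q"
proof -
  have "tunnel W X"
    unfolding tunnel_def
  proof (intro exI conjI allI impI)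
    show "finite {tunnel_band}" by simp
    show "\<forall>\<beta>\<in>{tunnel_band}. band \<beta>" using band_tunnel_band by simp
    show "W n \<subseteq> \<Union>{tunnel_band}" if "X n \<notin> cball 0 (norm (X 0))" for n
      using that W_subset_band[of n] by (cases n) auto
  qed
  moreover have "(LEAST l. repeats W X l) = Q"
    using repeats_Q repeats_ge by (rule Least_equality)
  ultimately show ?thesis
    unfolding tunnels_with_period_def using runs repeats_Q by metis
qed

end

section \<open>The two starting slopes and the family of bombs\<close>

lemma path_obtain:
  assumes "2 \<le> m"
  obtains c A :: int and j where "path m a b n = period_state m (a + A) (b + A - 2 * c) j" "j < 2 * m + 2"
    "c = 0 \<and> A = 0 \<and> n = j \<or> 1 \<le> c \<and> int m \<le> A \<and> 2 * c \<le> A"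
proof -
  obtain p j where pj: "n = p * (2 * m + 2) + j" "j < 2 * m + 2" by (rule path_cases)
  have "int m \<le> int p * m \<and> 2 * int p \<le> int p * m" if "1 \<le> int p"
    using that assms mult_right_mono[of 1 "int p" "int m"] mult_left_mono[of 2 "int m" "int p"]
    by (simp add: mult.commute)
  hence "int p = 0 \<and> int p * m = 0 \<and> n = j \<or> 1 \<le> int p \<and> int m \<le> int p * m \<and> 2 * int p \<le> int p * m"
    using pj(1) by (cases "p = 0") simp_all
  with path_eq[OF pj(2), of a b p] show thesis unfolding pj(1)[symmetric] by (rule that[OF _ pj(2)])
qed

text \<open>The first hit removes the top wall of its cell, as hit \<open>R\<close> of a previous
  period would have done, and the bounce leads to the first staircase hit.\<close>

lemma digging_up:
  assumes m: "2 \<le> m" and k: "int m + 6 \<le> k" and "0 < \<eta>" "\<eta> < 1"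
  shows "digging m k 0 0 0 (St 0 0 True True 0) \<eta>"
proof
  fix n
  obtain c A :: int and j where p: "path m 0 0 n = period_state m (0 + A) (0 + A - 2 * c) j" "j < 2 * m + 2"
    and c: "c = 0 \<and> A = 0 \<and> n = j \<or> 1 \<le> c \<and> int m \<le> A \<and> 2 * c \<le> A"
    using path_obtain[OF m] by metis
  show "next_edge (path m 0 0 n) \<notin> erased_by (digger m k) (St 0 0 True True 0)"
    unfolding p(1) using m p(2)
    by (cases rule: period_state_cases[where a = "0 + A" and b = "0 + A - 2 * c"];
        use c k m in \<open>auto simp: erased_by_def next_edge_def digger_def; linarith\<close>)
qed (use assms period_state_simps(1)[of 0 m 0 0] in \<open>auto simp: path_def erased_by_def digger_def\<close>)

text \<open>The origin is chosen so that the first wall hit is in the place of the trigger of the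
  joined period. The bounced particle moves as if it had just flown up through that wall, so it
  joins at hit \<open>2 * m - 3\<close>.\<close>

lemma digging_down:
  assumes m: "2 \<le> m" and k: "int m + 6 \<le> k" and "0 < \<eta>" "\<eta> < 1"
  shows "digging m k (1 - int m) (- int m) (2 * m - 3) (St 0 0 True False 0) \<eta>"
proof
  have "path m (1 - int m) (- int m) (2 * m - 3) = period_state m (1 - int m) (- int m) (2 * m - 3)"
    by (simp add: path_def)
  thus "bounce (St 0 0 True False 0) = path m (1 - int m) (- int m) (2 * m - 3)"
    using period_state_simps(3)[OF m] by simp
next
  fix n assume n: "2 * m - 3 \<le> n"
  obtain c A :: int and j where p: "path m (1 - int m) (- int m) n = period_state m (1 - int m + A) (- int m + A - 2 * c) j" "j < 2 * m + 2"
    and c: "c = 0 \<and> A = 0 \<and> n = j \<or> 1 \<le> c \<and> int m \<le> A \<and> 2 * c \<le> A"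
    using path_obtain[OF m] by metis
  have c': "c = 0 \<and> A = 0 \<and> 2 * int m \<le> int j + 3 \<or> 1 \<le> c \<and> int m \<le> A \<and> 2 * c \<le> A"
    using c n by auto
  show "next_edge (path m (1 - int m) (- int m) n) \<notin> erased_by (digger m k) (St 0 0 True False 0)"
    unfolding p(1) using m p(2)
    by (cases rule: period_state_cases[where a = "1 - int m + A" and b = "- int m + A - 2 * c"];
        use c' k m in \<open>auto simp: erased_by_def next_edge_def digger_def; linarith\<close>)
qed (use assms in \<open>simp_all add: erased_by_def digger_def\<close>)

text \<open>The inert wall is the only horizontal wall of the bomb with positive height, so
  \<open>k\<close> can be read off.\<close>

lemma inj_digger: "inj (\<lambda>e::nat. pts ` digger m (int m + 6 + int e))"
proof
  fix e e' :: nat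
  assume "pts ` digger m (int m + 6 + int e) = pts ` digger m (int m + 6 + int e')"
  hence eq: "digger m (int m + 6 + int e) = digger m (int m + 6 + int e')"
    by (simp only: inj_image_eq_iff[OF inj_pts])
  have "Hor (- (int m + 6 + int e)) (int m + 6 + int e) \<in> digger m (int m + 6 + int e)"
    by (simp add: digger_def)
  hence "Hor (- (int m + 6 + int e)) (int m + 6 + int e) \<in> digger m (int m + 6 + int e')"
    by (simp only: eq)
  thus "e = e'" by (simp add: digger_def)
qed

lemma bomb_digger: "bomb (pts ` digger m k)"
  unfolding bomb_def walls_eq marked_wall_eq by (auto simp: digger_def simp del: pts.simps)

theorem theorem1p3:
  fixes q :: nat
  assumes "q \<ge> 6" and "even q"
  shows "infinite {B. bomb B \<and>
           (\<forall>y s. 0 < y \<and> y < 1 \<and> s \<in> {3, -3} \<longrightarrow> tunnels_with_period B (start y s) q)}"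
proof -
  obtain m where q: "q = 2 * m + 2" and m: "2 \<le> m"
  proof -
    obtain l where "q = 2 * l" using assms(2) by (rule evenE)
    thus thesis using assms(1) by (intro that[of "l - 1"]) auto
  qed
  have "tunnels_with_period (pts ` digger m k) (start y s) q"
    if "int m + 6 \<le> k" "0 < y" "y < 1" "s \<in> {3, -3}" for k y s
    using that(4) digging.tunnels[OF digging_up[OF m that(1-3)]]
      digging.tunnels[OF digging_down[OF m that(1), of "1 - y"]] that(2,3)
    by (auto simp: start_eq q)
  hence "range (\<lambda>e::nat. pts ` digger m (int m + 6 + int e)) \<subseteq> {B. bomb B \<and>
      (\<forall>y s. 0 < y \<and> y < 1 \<and> s \<in> {3, -3} \<longrightarrow> tunnels_with_period B (start y s) q)}"
    using bomb_digger by auto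
  thus ?thesis using infinite_super range_inj_infinite[OF inj_digger] by blast
qed

end
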